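(* Every bivalent cactus graph is either formed by cycles of even length connected by equal links (with eigenvalue $\lambda=4$), or formed by chains $P_2$ connected by equal links (with eigenvalue $\lambda=2$).
   Context: Graphs are finite, simple and undirected. A cactus graph is a connected graph in which any two cycles have at most one vertex in common. The Laplacian of a graph $G$ is $L(G)=D-A$ ($D$ the diagonal matrix of degrees, $A$ the adjacency matrix). An eigenvector of $L(G)$ is bivalent if it is composed of the values $\{-1,+1\}$ (both values occurring). A graph is bivalent if its Laplacian has a bivalent eigenvector; the eigenvalue mentioned is the one afforded by that eigenvector. $P_2$ is the path on two vertices and carries the vector $[1,-1]^T$; an even cycle carries, in cyclic order, the alternating vector $[1,-1,\dots,1,-1]^T$. An equal link is an edge joining two vertices with the same value; graphs carrying vectors are connected by equal links when edges are added to their disjoint union, each joining two vertices having the same value in the combined vector. *)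

theory Defs
  imports
    "Graph_Theory.Graph_Theory"
    "Jordan_Normal_Form.Char_Poly"
    "HOL-Library.Disjoint_Sets"
begin

text \<open>
  A finite simple undirected graph is a \<^locale>\<open>pair_graph\<close>: a finite loop-free symmetric digraph
  without parallel arcs, an edge being represented by its two opposite arcs.
\<close>

subsection \<open>Cactus graphs\<close>

text \<open>
  In a symmetric digraph the closed walk \<open>a, b, a\<close> along a single edge is a directed cycle;
  the length bound excludes it.
\<close>

definition ucycle :: "'a pair_pre_digraph \<Rightarrow> ('a \<times> 'a) list \<Rightarrow> bool" where
  "ucycle G p \<longleftrightarrow> pre_digraph.cycle (with_proj G) p \<and> 3 \<le> length p"

text \<open>
  The undirected graph traced out by a cycle, given as its list of arcs. It depends neither on the
  starting vertex nor on the direction of traversal.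
\<close>

definition cycle_graph :: "('a \<times> 'a) list \<Rightarrow> 'a pair_pre_digraph" where
  "cycle_graph p = \<lparr> pverts = fst ` set p, parcs = set p \<union> (set p)\<inverse> \<rparr>"

definition cactus :: "'a pair_pre_digraph \<Rightarrow> bool" where
  "cactus G \<longleftrightarrow> pair_graph G \<and> connected (with_proj G) \<and>
    (\<forall>p q. ucycle G p \<and> ucycle G q \<and> cycle_graph p \<noteq> cycle_graph q \<longrightarrow>
      card (pverts (cycle_graph p) \<inter> pverts (cycle_graph q)) \<le> 1)"

subsection \<open>The Laplacian and bivalent eigenvectors\<close>

text \<open>
  Matrices and vectors are taken with respect to an enumeration \<open>vs\<close> of the vertices, each vertex
  being listed exactly once.
\<close>

definition degree_matrix :: "'a list \<Rightarrow> 'a pair_pre_digraph \<Rightarrow> real mat" where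
  "degree_matrix vs G = mat (length vs) (length vs)
     (\<lambda>(i, j). if i = j then real (out_degree (with_proj G) (vs ! i)) else 0)"

definition adjacency_matrix :: "'a list \<Rightarrow> 'a pair_pre_digraph \<Rightarrow> real mat" where
  "adjacency_matrix vs G = mat (length vs) (length vs)
     (\<lambda>(i, j). if (vs ! i, vs ! j) \<in> parcs G then 1 else 0)"

definition laplacian :: "'a list \<Rightarrow> 'a pair_pre_digraph \<Rightarrow> real mat" where
  "laplacian vs G = degree_matrix vs G - adjacency_matrix vs G"

text \<open>
  A vector is given by its value at each vertex; values outside \<^term>\<open>pverts G\<close> are irrelevant.
\<close>

definition bivalent_eigenvector ::
    "'a list \<Rightarrow> 'a pair_pre_digraph \<Rightarrow> ('a \<Rightarrow> real) \<Rightarrow> real \<Rightarrow> bool" where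
  "bivalent_eigenvector vs G x lam \<longleftrightarrow>
     eigenvector (laplacian vs G) (vec_of_list (map x vs)) lam \<and> x ` pverts G = {-1, 1}"

subsection \<open>Graphs connected by equal links\<close>

text \<open>
  \<open>G\<close> arises from the disjoint union of the graphs in \<open>\<H>\<close> by adding edges, each joining two
  vertices with the same value in the vector \<open>x\<close> on the union.
\<close>

definition connected_by_equal_links ::
    "'a pair_pre_digraph set \<Rightarrow> 'a pair_pre_digraph \<Rightarrow> ('a \<Rightarrow> real) \<Rightarrow> bool" where
  "connected_by_equal_links \<H> G x \<longleftrightarrow>
     disjoint_family_on pverts \<H> \<and>
     (\<Union>H\<in>\<H>. pverts H) = pverts G \<and>
     (\<forall>H\<in>\<H>. subgraph (with_proj H) (with_proj G)) \<and>
     (\<forall>(u, v) \<in> parcs G - (\<Union>H\<in>\<H>. parcs H). x u = x v)"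

definition alternating_even_cycle :: "'a pair_pre_digraph \<Rightarrow> ('a \<Rightarrow> real) \<Rightarrow> bool" where
  "alternating_even_cycle H x \<longleftrightarrow>
     (\<exists>p. ucycle H p \<and> even (length p) \<and> H = cycle_graph p \<and>
       (\<forall>i<length p. x (fst (p ! i)) = (-1) ^ i))"

definition alternating_P2 :: "'a pair_pre_digraph \<Rightarrow> ('a \<Rightarrow> real) \<Rightarrow> bool" where
  "alternating_P2 H x \<longleftrightarrow>
     (\<exists>u v. u \<noteq> v \<and> H = \<lparr> pverts = {u, v}, parcs = {(u, v), (v, u)} \<rparr> \<and> x u = 1 \<and> x v = -1)"

definition formed_by_even_cycles :: "'a pair_pre_digraph \<Rightarrow> ('a \<Rightarrow> real) \<Rightarrow> bool" where
  "formed_by_even_cycles G x \<longleftrightarrow>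
     (\<exists>\<H>. (\<forall>H\<in>\<H>. alternating_even_cycle H x) \<and> connected_by_equal_links \<H> G x)"

definition formed_by_P2s :: "'a pair_pre_digraph \<Rightarrow> ('a \<Rightarrow> real) \<Rightarrow> bool" where
  "formed_by_P2s G x \<longleftrightarrow>
     (\<exists>\<H>. (\<forall>H\<in>\<H>. alternating_P2 H x) \<and> connected_by_equal_links \<H> G x)"

end

theory Submission
  imports Defs
begin

text \<open>
  Multiplying the eigenvector equation at \<open>v\<close> by \<open>x v\<close> shows that every vertex has exactly
  \<open>lam / 2\<close> neighbours of the opposite value, so the edges joining unequal values form a
  \<open>d\<close>-regular graph with \<open>lam = 2 * d\<close>; connectivity gives \<open>d \<noteq> 0\<close>. In a cactus \<open>d \<le> 2\<close>: an end
  of a longest path has all its neighbours on the path, and three of them would close up two cycles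
  sharing the first edge of the path. For \<open>d = 1\<close> the unequal edges are a perfect matching. For
  \<open>d = 2\<close> they form disjoint cycles, along which the values alternate.
\<close>

section \<open>Cycles given by vertex lists\<close>

text \<open>The arc list expected by \<open>ucycle\<close> is derived from a vertex list, so that
  distinctness, prefixes and positions become plain list facts.\<close>

definition closed_arcs :: "'a list \<Rightarrow> ('a \<times> 'a) list" where
  "closed_arcs us = zip us (rotate1 us)"

lemma length_closed_arcs [simp]: "length (closed_arcs us) = length us"
  by (simp add: closed_arcs_def)

lemma nth_closed_arcs: "i < length us \<Longrightarrow> closed_arcs us ! i = (us ! i, us ! (Suc i mod length us))"
  by (simp add: closed_arcs_def nth_rotate1)

lemma set_closed_arcs:
  "set (closed_arcs us) = (\<lambda>i. (us ! i, us ! (Suc i mod length us))) ` {..<length us}"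
  by (auto simp: set_conv_nth[of "closed_arcs us"] nth_closed_arcs image_iff) (metis nth_closed_arcs)

lemma pverts_cycle_graph_closed_arcs [simp]: "pverts (cycle_graph (closed_arcs us)) = set us"
proof -
  have "map fst (closed_arcs us) = us"
    by (simp add: closed_arcs_def)
  then show ?thesis
    by (metis cycle_graph_def list.set_map pair_pre_digraph.select_convs(1))
qed

text \<open>The end \<open>w\<close> is left free for the induction to go through;
  \<open>w = hd us\<close> gives the closed walk.\<close>

lemma zip_tl_walk:
  assumes "us \<noteq> []"
  shows "pcas (hd us) (zip us (tl us @ [w])) w"
    and "pawalk_verts (hd us) (zip us (tl us @ [w])) = us @ [w]"
    and "set (zip us (tl us @ [w])) \<subseteq> R \<longleftrightarrow>
           successively (\<lambda>a b. (a, b) \<in> R) us \<and> (last us, w) \<in> R"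
  using assms
proof (induction us)
  case (Cons a us)
  {
    case 1
    then show ?case using Cons.IH(1) by (cases us) auto
  next
    case 2
    then show ?case using Cons.IH(2) by (cases us) auto
  next
    case 3
    then show ?case using Cons.IH(3) by (cases us) auto
  }
qed auto

lemma closed_arcs_subset_iff:
  assumes "us \<noteq> []"
  shows "set (closed_arcs us) \<subseteq> R \<longleftrightarrow>
           successively (\<lambda>a b. (a, b) \<in> R) us \<and> (last us, hd us) \<in> R"
  using zip_tl_walk(3)[OF assms, of "hd us" R] assms
  by (simp add: closed_arcs_def rotate1_hd_tl)

text \<open>The closed walk visits \<open>us @ [hd us]\<close>, and \<open>cycle\<close> requires
  the tail of this list to be distinct: it is a rotation of \<open>us\<close>.\<close>

lemma ucycle_closed_arcs:
  assumes "distinct us" "3 \<le> length us" "set (closed_arcs us) \<subseteq> parcs H" "hd us \<in> pverts H"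
  shows "ucycle H (closed_arcs us)"
proof -
  have ne: "us \<noteq> []" using assms(2) by auto
  have "closed_arcs us = zip us (tl us @ [hd us])"
    using ne by (simp add: closed_arcs_def rotate1_hd_tl)
  moreover have "distinct (tl us @ [hd us])"
    using assms(1) ne by (cases us) auto
  ultimately have "pre_digraph.cycle (with_proj H) (closed_arcs us)"
    using zip_tl_walk(1,2)[OF ne, of "hd us"] assms(2,3,4) ne
    unfolding pre_digraph.cycle_def pre_digraph.awalk_def
    by (intro exI[of _ "hd us"]) (auto simp: cas_with_proj_eq awalk_verts_with_proj_eq)
  then show ?thesis using assms(2) by (simp add: ucycle_def)
qed

section \<open>Maximal paths and the degree bound in a cactus\<close>

text \<open>Among the paths ending in \<open>v\<close> a longest one exists, since
  \<open>card V\<close> bounds the length. A predecessor of its head off the path could be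
  prepended.\<close>

lemma ex_maximal_path:
  assumes "finite V" "R \<subseteq> V \<times> V" "v \<in> V"
  obtains us where "us \<noteq> []" "last us = v" "distinct us" "set us \<subseteq> V"
    "successively (\<lambda>a b. (a, b) \<in> R) us" "\<And>w. (w, hd us) \<in> R \<Longrightarrow> w \<in> set us"
proof -
  let ?P = "\<lambda>us. us \<noteq> [] \<and> last us = v \<and> distinct us \<and> set us \<subseteq> V \<and>
    successively (\<lambda>a b. (a, b) \<in> R) us"
  have "?P [v]" using assms by auto
  moreover have "length us < Suc (card V)" if "?P us" for us
    using that assms(1) by (metis card_mono distinct_card less_Suc_eq_le)
  ultimately obtain us where us: "?P us" and max: "\<And>ws. ?P ws \<Longrightarrow> length ws \<le> length us"
    using ex_has_greatest_nat[of ?P "[v]" length "Suc (card V)"] by auto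
  have "w \<in> set us" if "(w, hd us) \<in> R" for w
  proof (rule ccontr)
    assume "w \<notin> set us"
    then have "?P (w # us)" using us that assms(2) by (cases us) auto
    then show False using max by fastforce
  qed
  then show thesis using that us by blast
qed

text \<open>Counting neighbours by position lets a degree assumption yield neighbours beyond the
  first two vertices of a path.\<close>

lemma card_neighbour_indices:
  assumes "distinct us" "R `` {a} \<subseteq> set us"
  shows "card {i. i < length us \<and> (a, us ! i) \<in> R} = card (R `` {a})"
proof -
  have "bij_betw ((!) us) {i. i < length us \<and> (a, us ! i) \<in> R} (R `` {a})"
    using assms by (auto simp: bij_betw_def inj_on_def nth_eq_iff_index_eq in_set_conv_nth image_iff
        subset_iff)
  then show ?thesis by (rule bij_betw_same_card)
qed

text \<open>If all degrees were at least 3, the head of a maximal path would have two neighbours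
  beyond position 1. Each closes a prefix of the path to a cycle, and both cycles contain the first
  two vertices.\<close>

lemma cactus_degree_le_2:
  assumes "cactus G" "R \<subseteq> parcs G" "sym R" "v0 \<in> pverts G"
  shows "\<exists>v\<in>pverts G. card (R `` {v}) \<le> 2"
proof (rule ccontr)
  assume "\<not> ?thesis"
  then have deg: "3 \<le> card (R `` {v})" if "v \<in> pverts G" for v using that by force
  interpret pair_graph G using assms(1) by (simp add: cactus_def)
  have RV: "R \<subseteq> pverts G \<times> pverts G"
    using assms(2) by (auto dest: wellformed')
  obtain us where us: "us \<noteq> []" "distinct us" "set us \<subseteq> pverts G"
    and walk: "successively (\<lambda>a b. (a, b) \<in> R) us"
    and max: "\<And>w. (w, hd us) \<in> R \<Longrightarrow> w \<in> set us"
    using ex_maximal_path[OF pair_finite_verts RV assms(4)] by metis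
  define a where "a = hd us"
  have a0: "a = us ! 0" using us(1) by (simp add: a_def hd_conv_nth)
  have aV: "a \<in> pverts G" using us by (auto simp: a_def)
  define I where "I = {i. i < length us \<and> (a, us ! i) \<in> R}"
  have "R `` {a} \<subseteq> set us"
    using max assms(3) by (auto simp: a_def dest: symD)
  then have "card I = card (R `` {a})"
    unfolding I_def by (rule card_neighbour_indices[OF us(2)])
  then have "3 \<le> card I"
    using deg[OF aV] by simp
  moreover have "0 \<notin> I"
    using assms(2) pair_no_loops[of "(a, a)"] by (auto simp: I_def a0)
  then have "I - {0, 1} = I - {1}" by auto
  \<comment> \<open>Of at least three positions only 1 can be lost. Position 1 is dropped because
    closing up there would give length 2, too short for \<open>ucycle\<close>.\<close>
  ultimately have "2 \<le> card (I - {0, 1})"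
    using diff_card_le_card_Diff[of "{1}" I] by simp
  then obtain J where "J \<subseteq> I - {0, 1}" "card J = 2"
    by (meson obtain_subset_with_card_n)
  then obtain i j where ij: "i \<in> I - {0, 1}" "j \<in> I - {0, 1}" "i \<noteq> j"
    by (auto simp: card_2_iff)
  let ?p = "\<lambda>i. closed_arcs (take (Suc i) us)"
  have cyc: "ucycle G (?p k)" if "k \<in> I - {0, 1}" for k
  proof (rule ucycle_closed_arcs)
    have k: "k < length us" "2 \<le> k" "(a, us ! k) \<in> R" using that by (auto simp: I_def)
    then show "3 \<le> length (take (Suc k) us)" by simp
    have "successively (\<lambda>a b. (a, b) \<in> R) (take (Suc k) us)"
      using walk by (metis append_take_drop_id successively_append_iff)
    moreover have "(last (take (Suc k) us), hd (take (Suc k) us)) \<in> R"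
      using k assms(3) us(1) by (simp add: take_Suc_conv_app_nth a_def[symmetric] hd_append symD)
    moreover have "take (Suc k) us \<noteq> []" using us(1) by simp
    ultimately show "set (?p k) \<subseteq> parcs G"
      using closed_arcs_subset_iff assms(2) by blast
    show "hd (take (Suc k) us) \<in> pverts G" using aV by (simp add: a_def)
  qed (simp add: us)
  \<comment> \<open>Different numbers of vertices tell the two cycle graphs apart.\<close>
  have card: "card (set (take (Suc k) us)) = Suc k" if "k \<in> I" for k
    using that us(2) by (simp add: I_def distinct_card)
  have "cycle_graph (?p i) \<noteq> cycle_graph (?p j)"
    using card[of i] card[of j] ij by (metis DiffE Suc_inject pverts_cycle_graph_closed_arcs)
  then have le: "card (set (take (Suc i) us) \<inter> set (take (Suc j) us)) \<le> 1"
    using assms(1) cyc[OF ij(1)] cyc[OF ij(2)] unfolding cactus_def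
    by (metis pverts_cycle_graph_closed_arcs)
  have "1 < length us" using ij(1) by (auto simp: I_def)
  moreover have "us ! l \<in> set (take (Suc k) us)" if "l < 2" "k \<in> I - {0, 1}" for k l
    using that by (auto simp: in_set_conv_nth I_def intro!: exI[of _ l])
  ultimately have "{us ! 0, us ! 1} \<subseteq> set (take (Suc i) us) \<inter> set (take (Suc j) us)" "us ! 0 \<noteq> us ! 1"
    using ij us(1,2) by (auto simp: nth_eq_iff_index_eq)
  then have "2 \<le> card (set (take (Suc i) us) \<inter> set (take (Suc j) us))"
    using card_mono[of "set (take (Suc i) us) \<inter> set (take (Suc j) us)" "{us ! 0, us ! 1}"] by simp
  then show False using le by simp
qed

section \<open>Cycles in two-regular graphs\<close>

text \<open>The head of a maximal path has a neighbour at some position \<open>i\<close> beyond 1.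
  Were \<open>us ! i\<close> not the last vertex, it would have three neighbours: its two path
  neighbours and the head. So the whole path closes up.\<close>

lemma two_regular_ex_cycle:
  assumes "finite V" "R \<subseteq> V \<times> V" "sym R" "irrefl R"
    and deg: "\<And>v. v \<in> V \<Longrightarrow> card (R `` {v}) = 2" and "v \<in> V"
  obtains us where "distinct us" "3 \<le> length us" "last us = v" "set (closed_arcs us) \<subseteq> R"
proof -
  obtain us where us: "us \<noteq> []" "distinct us" "set us \<subseteq> V" "last us = v"
    and walk: "successively (\<lambda>a b. (a, b) \<in> R) us"
    and max: "\<And>w. (w, hd us) \<in> R \<Longrightarrow> w \<in> set us"
    using ex_maximal_path[OF assms(1,2,6)] by metis
  define a where "a = hd us"
  have a0: "a = us ! 0" using us(1) by (simp add: a_def hd_conv_nth)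
  have aV: "a \<in> V" using us by (auto simp: a_def)
  define I where "I = {i. i < length us \<and> (a, us ! i) \<in> R}"
  have "R `` {a} \<subseteq> set us"
    using max assms(3) by (auto simp: a_def dest: symD)
  then have "card I = card (R `` {a})"
    unfolding I_def by (rule card_neighbour_indices[OF us(2)])
  then have "card I = 2"
    using deg[OF aV] by simp
  moreover have "0 \<notin> I"
    using assms(4) by (auto simp: I_def a0 irrefl_def)
  ultimately obtain i where i: "i \<in> I" "i \<noteq> 0" "i \<noteq> 1"
    by (auto simp: card_2_iff)
  have "Suc i = length us"
  proof (rule ccontr)
    assume "Suc i \<noteq> length us"
    then have lt: "Suc i < length us" using i by (simp add: I_def)
    \<comment> \<open>The predecessor of \<open>i\<close> on the path. It is positive, so
      \<open>us ! j\<close> differs from the head.\<close>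
    define j where "j = i - 1"
    have ij: "i = Suc j" "0 < j" using i by (auto simp: j_def)
    have "(us ! j, us ! i) \<in> R" "(us ! i, us ! Suc i) \<in> R" "(us ! 0, us ! i) \<in> R"
      using walk lt ij i by (auto simp: successively_conv_nth I_def a0)
    then have sub: "{us ! j, us ! Suc i, us ! 0} \<subseteq> R `` {us ! i}"
      using assms(3) by (auto dest: symD)
    have neq: "us ! j \<noteq> us ! Suc i" "us ! j \<noteq> us ! 0" "us ! Suc i \<noteq> us ! 0"
      using lt ij us(1,2) by (auto simp: nth_eq_iff_index_eq)
    have two: "card (R `` {us ! i}) = 2" using deg[of "us ! i"] us(3) lt by force
    \<comment> \<open>An infinite set would have cardinality 0.\<close>
    then have "finite (R `` {us ! i})" using card.infinite by fastforce
    then have "card {us ! j, us ! Suc i, us ! 0} \<le> 2" using card_mono[OF _ sub] two by simp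
    then show False using neq by simp
  qed
  then have "last us = us ! i" by (metis diff_Suc_1 last_conv_nth us(1))
  then have "(last us, hd us) \<in> R"
    using i assms(3) by (auto simp: I_def a_def dest: symD)
  then have "set (closed_arcs us) \<subseteq> R"
    using walk closed_arcs_subset_iff us(1) by blast
  moreover have "3 \<le> length us" using i \<open>Suc i = length us\<close> by simp
  ultimately show thesis using that us by blast
qed

text \<open>
  A cycle in a 2-regular graph uses up all edges at its vertices, so it is a connected component.
\<close>

lemma two_regular_cycle_saturated:
  assumes "sym R" and deg: "\<And>v. v \<in> set us \<Longrightarrow> card (R `` {v}) = 2"
    and us: "distinct us" "3 \<le> length us" "set (closed_arcs us) \<subseteq> R"
  shows "parcs (cycle_graph (closed_arcs us)) = R \<inter> (set us \<times> UNIV)"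
    and "R `` set us \<subseteq> set us"
proof -
  let ?A = "parcs (cycle_graph (closed_arcs us))"
  let ?n = "length us"
  have A: "?A = set (closed_arcs us) \<union> (set (closed_arcs us))\<inverse>"
    by (simp add: cycle_graph_def)
  have AR: "?A \<subseteq> R" using A us(3) assms(1) by (auto dest: symD)
  have "Suc i mod ?n < ?n" if "i < ?n" for i
    using that by (intro mod_less_divisor) linarith
  then have AU: "?A \<subseteq> set us \<times> set us" by (auto simp: A set_closed_arcs)
  have nb: "R `` {us ! k} = ?A `` {us ! k}" if k: "k < ?n" for k
  proof -
    \<comment> \<open>\<open>s\<close> and \<open>t\<close> are the cyclic successor and predecessor
      of \<open>k\<close>; the case split avoids truncated subtraction at 0. With at least three
      vertices they differ, so they already account for both neighbours in \<open>R\<close>.\<close>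
    define s where "s = Suc k mod ?n"
    define t where "t = (if k = 0 then ?n - 1 else k - 1)"
    have t: "t < ?n" "Suc t mod ?n = k" using k by (auto simp: t_def)
    have s: "s < ?n" using k by (auto simp: s_def intro!: mod_less_divisor)
    have st: "s \<noteq> t"
      using k us(2) by (cases "Suc k = ?n") (auto simp: s_def t_def)
    have "(us ! k, us ! s) \<in> set (closed_arcs us)" "(us ! t, us ! k) \<in> set (closed_arcs us)"
      using k t by (auto simp: set_closed_arcs s_def image_iff)
    then have sub: "{us ! s, us ! t} \<subseteq> ?A `` {us ! k}" by (auto simp: A)
    have c2: "card {us ! s, us ! t} = 2"
      using st s t us(1) by (simp add: nth_eq_iff_index_eq)
    have cR: "card (R `` {us ! k}) = 2" using deg k by simp
    then have fin: "finite (R `` {us ! k})" using card.infinite by fastforce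
    have "?A `` {us ! k} \<subseteq> R `` {us ! k}" using AR by auto
    then have "{us ! s, us ! t} = R `` {us ! k}"
      using sub c2 cR fin by (intro card_subset_eq) auto
    then show ?thesis using sub \<open>?A `` {us ! k} \<subseteq> R `` {us ! k}\<close> by auto
  qed
  then have "(u, w) \<in> ?A" if "u \<in> set us" "(u, w) \<in> R" for u w
    using that by (auto simp: in_set_conv_nth)
  then show "?A = R \<inter> (set us \<times> UNIV)" and "R `` set us \<subseteq> set us"
    using AR AU by auto
qed

text \<open>Symmetry lets membership in \<open>S\<close> pass both ways along each arc. Applied to
  saturated cycles, this shows that two which meet have the same vertices.\<close>

lemma successively_subset_closed_set:
  assumes "successively (\<lambda>a b. (a, b) \<in> R) us" "sym R" "R `` S \<subseteq> S" "set us \<inter> S \<noteq> {}"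
  shows "set us \<subseteq> S"
  using assms(1,4)
proof (induction us rule: induct_list012)
  case (3 a b us)
  have "a \<in> S \<longleftrightarrow> b \<in> S"
    using 3(3) assms(2,3) by (auto dest: symD)
  moreover have "set (b # us) \<subseteq> S" if "set (b # us) \<inter> S \<noteq> {}"
    using 3 that by simp
  ultimately show ?case using 3(4) by auto
qed auto

section \<open>Assembling the decompositions\<close>

text \<open>Here \<open>R\<close> is a perfect matching; its edges are the blocks, and every other
  edge of \<open>G\<close> joins equal values.\<close>

lemma formed_by_P2sI:
  fixes G :: "'a pair_pre_digraph" and x :: "'a \<Rightarrow> real"
  assumes "pair_graph G" and x: "x ` pverts G \<subseteq> {-1, 1}"
    and R: "R = {(u, v) \<in> parcs G. x u \<noteq> x v}"
    and deg: "\<And>v. v \<in> pverts G \<Longrightarrow> card (R `` {v}) = 1"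
  shows "formed_by_P2s G x"
proof -
  interpret pair_graph G by fact
  have symR: "(v, u) \<in> R" if "(u, v) \<in> R" for u v
    using that pair_sym_arcs by (auto simp: R symmetric_def dest: symD)
  have RV: "u \<in> pverts G" "v \<in> pverts G" if "(u, v) \<in> R" for u v
    using that by (auto simp: R dest: wellformed')
  have uniq: "v = w" if "(u, v) \<in> R" "(u, w) \<in> R" for u v w
    using that deg[OF RV(1)[OF that(1)]] by (metis Image_singleton_iff card_1_singletonE singletonD)
  have ex: "\<exists>v. (u, v) \<in> R" if "u \<in> pverts G" for u
    using deg[OF that] by (auto simp: card_1_singleton_iff)
  have opp: "x u = 1 \<and> x v = -1 \<or> x u = -1 \<and> x v = 1" if "(u, v) \<in> R" for u v
  proof -
    have "x u \<in> {-1, 1}" "x v \<in> {-1, 1}" using RV[OF that] x by blast+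
    then show ?thesis using that by (auto simp: R)
  qed
  define H where "H = (\<lambda>u v :: 'a. \<lparr> pverts = {u, v}, parcs = {(u, v), (v, u)} \<rparr>)"
  \<comment> \<open>Naming the endpoint of value 1 first fixes one orientation per edge, the one
    used by \<open>alternating_P2\<close>.\<close>
  define \<H> where "\<H> = {H u v | u v. (u, v) \<in> R \<and> x u = 1}"
  have cover: "\<exists>H\<in>\<H>. u \<in> pverts H \<and> (u, v) \<in> parcs H" if uv: "(u, v) \<in> R" for u v
  proof -
    have "H u v \<in> \<H> \<or> H v u \<in> \<H>"
      using opp[OF uv] symR[OF uv] uv unfolding \<H>_def by blast
    moreover have "u \<in> pverts K \<and> (u, v) \<in> parcs K" if "K = H u v \<or> K = H v u" for K
      using that by (auto simp: H_def)
    ultimately show ?thesis by blast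
  qed
  have "alternating_P2 K x" if "K \<in> \<H>" for K
  proof -
    obtain u v where K: "K = H u v" "(u, v) \<in> R" "x u = 1" using \<open>K \<in> \<H>\<close> by (auto simp: \<H>_def)
    then have "x v = -1" "u \<noteq> v" using opp[of u v] by (auto simp: R)
    then show ?thesis using K by (auto simp: H_def alternating_P2_def)
  qed
  moreover have "connected_by_equal_links \<H> G x"
    unfolding connected_by_equal_links_def
  proof (intro conjI)
    show "disjoint_family_on pverts \<H>"
      unfolding disjoint_family_on_def
    proof (intro ballI impI)
      fix K L assume "K \<in> \<H>" "L \<in> \<H>" "K \<noteq> L"
      then obtain u v u' v' where K: "K = H u v" "(u, v) \<in> R" "x u = 1"
        and L: "L = H u' v'" "(u', v') \<in> R" "x u' = 1" by (auto simp: \<H>_def)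
      \<comment> \<open>A vertex shared by two blocks in different roles is excluded by its value,
        one shared in the same role by uniqueness of the partner.\<close>
      have "x v = -1" "x v' = -1" using opp[OF K(2)] opp[OF L(2)] K(3) L(3) by auto
      then have "u \<noteq> v'" "v \<noteq> u'" using K L by auto
      moreover have "u \<noteq> u'" "v \<noteq> v'" using K L \<open>K \<noteq> L\<close> uniq symR by blast+
      ultimately show "pverts K \<inter> pverts L = {}" by (auto simp: K L H_def)
    qed
    show "(\<Union>K\<in>\<H>. pverts K) = pverts G"
    proof
      show "(\<Union>K\<in>\<H>. pverts K) \<subseteq> pverts G" using RV by (auto simp: \<H>_def H_def)
      show "pverts G \<subseteq> (\<Union>K\<in>\<H>. pverts K)"
      proof
        fix u assume "u \<in> pverts G"
        then obtain v where "(u, v) \<in> R" using ex by blast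
        then show "u \<in> (\<Union>K\<in>\<H>. pverts K)" using cover[of u v] by auto
      qed
    qed
    show "\<forall>K\<in>\<H>. subgraph (with_proj K) (with_proj G)"
    proof
      fix K assume "K \<in> \<H>"
      then obtain u v where K: "K = H u v" "(u, v) \<in> R" by (auto simp: \<H>_def)
      then show "subgraph (with_proj K) (with_proj G)"
        using RV[OF K(2)] symR[OF K(2)] wf_digraph_axioms
        by (auto simp: subgraph_def H_def R wf_digraph_def)
    qed
    show "\<forall>(u, v)\<in>parcs G - (\<Union>K\<in>\<H>. parcs K). x u = x v"
    proof clarify
      fix u v assume "(u, v) \<in> parcs G" "(u, v) \<notin> (\<Union>K\<in>\<H>. parcs K)"
      then have "(u, v) \<notin> R" using cover[of u v] by auto
      then show "x u = x v" using \<open>(u, v) \<in> parcs G\<close> by (auto simp: R)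
    qed
  qed
  ultimately show ?thesis unfolding formed_by_P2s_def by blast
qed

text \<open>The components of the 2-regular graph \<open>R\<close> are cycles. Values change sign
  along each arc of \<open>R\<close>, which forces even length.\<close>

lemma formed_by_even_cyclesI:
  fixes G :: "'a pair_pre_digraph" and x :: "'a \<Rightarrow> real"
  assumes "pair_graph G" and x: "x ` pverts G \<subseteq> {-1, 1}"
    and R: "R = {(u, v) \<in> parcs G. x u \<noteq> x v}"
    and deg: "\<And>v. v \<in> pverts G \<Longrightarrow> card (R `` {v}) = 2"
  shows "formed_by_even_cycles G x"
proof -
  interpret pair_graph G by fact
  have symR: "sym R"
    using pair_sym_arcs by (auto simp: R symmetric_def sym_def)
  have RV: "R \<subseteq> pverts G \<times> pverts G"
    by (auto simp: R dest: wellformed')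
  have irr: "irrefl R" by (auto simp: R irrefl_def)
  have opp: "x v = - x u" if "(u, v) \<in> R" for u v
  proof -
    have "x u \<in> {-1, 1}" "x v \<in> {-1, 1}" using that RV x by blast+
    then show ?thesis using that by (auto simp: R)
  qed
  have ex: "\<exists>v. (u, v) \<in> R" if "u \<in> pverts G" for u
    using deg[OF that] by (auto simp: card_2_iff)
  \<comment> \<open>Lists start at value 1 to match the pattern \<open>(-1) ^ i\<close>. Different
    lists for one cycle yield the same graph, so they do no harm to disjointness.\<close>
  define C where "C = {us. distinct us \<and> 3 \<le> length us \<and> set (closed_arcs us) \<subseteq> R \<and> x (hd us) = 1}"
  have C_ne: "us \<noteq> []" if "us \<in> C" for us using that by (auto simp: C_def)
  have C_walk: "successively (\<lambda>a b. (a, b) \<in> R) us" "(last us, hd us) \<in> R" if "us \<in> C" for us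
    using that closed_arcs_subset_iff[OF C_ne[OF that]] by (auto simp: C_def)
  have C_V: "set us \<subseteq> pverts G" if "us \<in> C" for us
  proof -
    have "set us = fst ` set (closed_arcs us)"
      using pverts_cycle_graph_closed_arcs[of us] by (simp add: cycle_graph_def)
    then show ?thesis using that RV by (auto simp: C_def)
  qed
  have sat: "parcs (cycle_graph (closed_arcs us)) = R \<inter> (set us \<times> UNIV)" "R `` set us \<subseteq> set us"
    if "us \<in> C" for us
  proof -
    have "card (R `` {v}) = 2" if "v \<in> set us" for v using that C_V[OF \<open>us \<in> C\<close>] deg by auto
    then show "parcs (cycle_graph (closed_arcs us)) = R \<inter> (set us \<times> UNIV)" "R `` set us \<subseteq> set us"
      using two_regular_cycle_saturated[OF symR] that by (auto simp: C_def)
  qed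
  \<comment> \<open>The maximal path is rooted at its last vertex, so a root of value \<open>-1\<close> gives a head of value 1.\<close>
  have cover_neg: "\<exists>us\<in>C. v \<in> set us" if v: "v \<in> pverts G" and neg: "x v = -1" for v
  proof -
    obtain us where us: "distinct us" "3 \<le> length us" "last us = v" "set (closed_arcs us) \<subseteq> R"
      by (rule two_regular_ex_cycle[OF pair_finite_verts RV symR irr deg v])
    then have ne: "us \<noteq> []" by auto
    then have "(v, hd us) \<in> R" using us closed_arcs_subset_iff by blast
    then have "x (hd us) = 1" using opp neg by fastforce
    then show ?thesis using us ne by (auto simp: C_def)
  qed
  have cover: "\<exists>us\<in>C. v \<in> set us" if v: "v \<in> pverts G" for v
  proof (cases "x v = -1")
    case False
    then have "x v = 1" using x v by auto
    \<comment> \<open>A vertex of value 1 is reached through a neighbour of value -1: the cycle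
      covering \<open>w\<close> is saturated, hence contains \<open>v\<close>.\<close>
    obtain w where w: "(v, w) \<in> R" using ex v by blast
    then have "x w = -1" "w \<in> pverts G" using opp[OF w] \<open>x v = 1\<close> RV by auto
    then obtain us where us: "us \<in> C" "w \<in> set us" using cover_neg by blast
    then have "v \<in> set us" using sat(2)[OF us(1)] w symR by (auto dest: symD)
    then show ?thesis using us by blast
  qed (use cover_neg v in blast)
  define \<H> where "\<H> = (\<lambda>us. cycle_graph (closed_arcs us)) ` C"
  have "alternating_even_cycle (cycle_graph (closed_arcs us)) x" if "us \<in> C" for us
  proof -
    have hd1: "x (hd us) = 1" using that by (simp add: C_def)
    have alt: "x (us ! i) = (-1) ^ i" if "i < length us" for i
      using that
    proof (induction i)
      case 0
      then show ?case using hd1 hd_conv_nth[OF C_ne[OF \<open>us \<in> C\<close>]] by simp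
    next
      case (Suc i)
      then have "(us ! i, us ! Suc i) \<in> R"
        using C_walk(1)[OF \<open>us \<in> C\<close>] by (simp add: successively_conv_nth)
      then show ?case using opp Suc by fastforce
    qed
    \<comment> \<open>The closing arc gives the last value, which alternation from the head gives as
      a power of -1; comparing the two yields the parity.\<close>
    have "x (last us) = -1"
      using opp[OF C_walk(2)[OF that]] hd1 by simp
    then have "(-1 :: real) ^ (length us - 1) = -1"
      using alt[of "length us - 1"] C_ne[OF that] by (simp add: last_conv_nth)
    then have "odd (length us - 1)" by (metis neg_one_even_power one_neq_neg_one)
    then have "even (length us)" by (cases "length us") auto
    moreover have "set (closed_arcs us) \<subseteq> parcs (cycle_graph (closed_arcs us))"
      by (simp add: cycle_graph_def)
    then have "ucycle (cycle_graph (closed_arcs us)) (closed_arcs us)"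
      using that C_ne[OF that] by (intro ucycle_closed_arcs) (simp_all add: C_def)
    ultimately show ?thesis
      unfolding alternating_even_cycle_def
      by (intro exI[of _ "closed_arcs us"]) (auto simp: nth_closed_arcs alt)
  qed
  then have "\<forall>H\<in>\<H>. alternating_even_cycle H x" by (auto simp: \<H>_def)
  moreover have "connected_by_equal_links \<H> G x"
    unfolding connected_by_equal_links_def
  proof (intro conjI)
    have same: "set us \<subseteq> set ws" if "us \<in> C" "ws \<in> C" "set us \<inter> set ws \<noteq> {}" for us ws
      using successively_subset_closed_set[OF C_walk(1) symR sat(2)] that by blast
    show "disjoint_family_on pverts \<H>"
      unfolding disjoint_family_on_def
    proof (intro ballI impI)
      fix K L assume "K \<in> \<H>" "L \<in> \<H>" "K \<noteq> L"
      then obtain us ws where K: "K = cycle_graph (closed_arcs us)" "us \<in> C"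
        and L: "L = cycle_graph (closed_arcs ws)" "ws \<in> C" by (auto simp: \<H>_def)
      show "pverts K \<inter> pverts L = {}"
      proof (rule ccontr)
        assume "pverts K \<inter> pverts L \<noteq> {}"
        then have "set us = set ws" using same[of us ws] same[of ws us] K L by auto
        \<comment> \<open>By saturation the vertex set determines the arcs.\<close>
        then have "K = L" using sat(1)[OF K(2)] sat(1)[OF L(2)] K L by (simp add: pair_pre_digraph.equality)
        then show False using \<open>K \<noteq> L\<close> by blast
      qed
    qed
    show "(\<Union>K\<in>\<H>. pverts K) = pverts G"
      using cover C_V by (fastforce simp: \<H>_def)
    show "\<forall>K\<in>\<H>. subgraph (with_proj K) (with_proj G)"
    proof
      fix K assume "K \<in> \<H>"
      then obtain us where us: "K = cycle_graph (closed_arcs us)" "us \<in> C" by (auto simp: \<H>_def)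
      then show "subgraph (with_proj K) (with_proj G)"
        using C_V[OF us(2)] sat[OF us(2)] wf_digraph_axioms
        by (auto simp: subgraph_def R wf_digraph_def)
    qed
    show "\<forall>(u, v)\<in>parcs G - (\<Union>K\<in>\<H>. parcs K). x u = x v"
    proof clarify
      fix u v assume uv: "(u, v) \<in> parcs G" "(u, v) \<notin> (\<Union>K\<in>\<H>. parcs K)"
      obtain us where us: "us \<in> C" "u \<in> set us" using cover uv(1) in_arcsD1 by blast
      then have "(u, v) \<notin> R" using uv(2) sat(1)[OF us(1)] by (auto simp: \<H>_def)
      then show "x u = x v" using uv(1) by (auto simp: R)
    qed
  qed
  ultimately show ?thesis unfolding formed_by_even_cycles_def by blast
qed

section \<open>The eigenvector equation and connectedness\<close>

text \<open>The equation at \<open>v\<close> reads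
  \<open>lam * x v = (\<Sum>w\<in>?N. x v - x w)\<close>. After multiplication by
  \<open>x v\<close>, each neighbour of opposite value contributes 2 and the others 0. The
  \<open>v\<close> inside the set comprehension is bound there; only the image refers to the fixed
  vertex.\<close>

lemma bivalent_eigenvector_degree:
  fixes G :: "'a pair_pre_digraph" and x :: "'a \<Rightarrow> real"
  assumes "pair_graph G" "distinct vs" "set vs = pverts G" "bivalent_eigenvector vs G x lam"
    and v: "v \<in> pverts G"
  shows "lam = 2 * card ({(u, v) \<in> parcs G. x u \<noteq> x v} `` {v})"
proof -
  interpret pair_graph G by fact
  let ?n = "length vs" and ?N = "parcs G `` {v}" and ?xv = "vec_of_list (map x vs)"
  have pm: "x w = 1 \<or> x w = -1" if "w \<in> pverts G" for w
    using assms(4) that by (auto simp: bivalent_eigenvector_def)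
  obtain i where i: "i < ?n" "vs ! i = v" using v assms(3) by (metis in_set_conv_nth)
  have NV: "?N \<subseteq> set vs" using assms(3) by (auto dest: wellformed')
  then have fin: "finite ?N" using finite_subset by blast
  have "out_arcs (with_proj G) v = Pair v ` ?N" by (auto simp: out_arcs_def)
  then have deg: "out_degree (with_proj G) v = card ?N"
    by (simp add: out_degree_def card_image inj_on_def)
  have ev: "laplacian vs G *\<^sub>v ?xv = lam \<cdot>\<^sub>v ?xv"
    using assms(4) by (auto simp: bivalent_eigenvector_def eigenvector_def)
  have "lam * x v = (lam \<cdot>\<^sub>v ?xv) $ i" using i by (simp add: vec_of_list_index)
  also have "\<dots> = (laplacian vs G *\<^sub>v ?xv) $ i" by (simp only: ev)
  also have "\<dots> = (\<Sum>j<?n. ((if i = j then real (card ?N) else 0)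
                   - (if (v, vs ! j) \<in> parcs G then 1 else 0)) * x (vs ! j))"
    using i by (auto simp: laplacian_def degree_matrix_def adjacency_matrix_def scalar_prod_def
        vec_of_list_index deg[folded i(2)] lessThan_atLeast0 intro!: sum.cong)
  also have "\<dots> = (\<Sum>j<?n. if i = j then card ?N * x v else 0)
                   - (\<Sum>j<?n. if (v, vs ! j) \<in> parcs G then x (vs ! j) else 0)"
    unfolding sum_subtractf[symmetric] using i by (intro sum.cong) (auto simp: algebra_simps)
  also have "(\<Sum>j<?n. if i = j then card ?N * x v else 0) = card ?N * x v"
    using i by simp
  \<comment> \<open>Distinctness of \<open>vs\<close> turns the sum over positions into a sum over
    vertices.\<close>
  also have "(\<Sum>j<?n. if (v, vs ! j) \<in> parcs G then x (vs ! j) else 0)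
             = (\<Sum>w\<in>set vs. if (v, w) \<in> parcs G then x w else 0)"
    using assms(2) by (intro sum.reindex_bij_betw bij_betw_nth) auto
  also have "\<dots> = (\<Sum>w\<in>?N. x w)"
    using NV by (intro sum.mono_neutral_cong_right) auto
  finally have "lam * x v = (\<Sum>w\<in>?N. x v - x w)" by (simp add: sum_subtractf)
  then have "lam * (x v * x v) = (\<Sum>w\<in>?N. (x v - x w) * x v)"
    by (simp add: sum_distrib_right mult.assoc[symmetric])
  also have "\<dots> = (\<Sum>w\<in>?N. if x v \<noteq> x w then 2 else 0)"
  proof (intro sum.cong refl)
    fix w assume "w \<in> ?N"
    then have "w \<in> pverts G" using NV assms(3) by auto
    then show "(x v - x w) * x v = (if x v \<noteq> x w then 2 else 0)"
      using pm[OF v] pm[of w] by auto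
  qed
  also have "\<dots> = 2 * card {w \<in> ?N. x v \<noteq> x w}"
    using fin by (simp add: sum.If_cases Int_def)
  also have "{w \<in> ?N. x v \<noteq> x w} = {(u, v) \<in> parcs G. x u \<noteq> x v} `` {v}" by auto
  \<comment> \<open>The factor \<open>x v * x v\<close> is 1.\<close>
  finally show ?thesis using pm[OF v] by auto
qed

text \<open>Otherwise \<open>x\<close> is constant along directed paths, and in a symmetric digraph
  connectedness gives a directed path from \<open>a\<close> to \<open>b\<close>.\<close>

lemma connected_ex_unequal_arc:
  assumes "pair_graph G" "connected (with_proj G)" "a \<in> pverts G" "b \<in> pverts G" "x a \<noteq> x b"
  shows "\<exists>(u, v)\<in>parcs G. x u \<noteq> x v"
proof (rule ccontr)
  assume neg: "\<not> ?thesis"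
  interpret pair_graph G by fact
  have "strongly_connected (with_proj G)"
    using assms(2) by (intro symmetric_connected_imp_strongly_connected pair_sym_arcs)
  then have "a \<rightarrow>\<^sup>*\<^bsub>with_proj G\<^esub> b" using assms by auto
  then have "x a = x b"
    using neg by (induction rule: reachable_induct) auto
  then show False using assms by blast
qed

theorem theorem5p5:
  fixes G :: "'a pair_pre_digraph" and vs :: "'a list" and x :: "'a \<Rightarrow> real" and lam :: real
  assumes "cactus G"
    and "distinct vs" and "set vs = pverts G"
    and "bivalent_eigenvector vs G x lam"
  shows "(formed_by_even_cycles G x \<and> lam = 4) \<or> (formed_by_P2s G x \<and> lam = 2)"
proof -
  interpret pair_graph G using assms(1) by (simp add: cactus_def)
  have pg: "pair_graph G" by unfold_locales
  have x: "x ` pverts G = {-1, 1}" using assms(4) by (simp add: bivalent_eigenvector_def)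
  define R where "R = {(u, v) \<in> parcs G. x u \<noteq> x v}"
  have lam: "lam = 2 * card (R `` {v})" if "v \<in> pverts G" for v
    using bivalent_eigenvector_degree[OF pg assms(2-4) that] by (simp add: R_def)
  obtain a b where ab: "a \<in> pverts G" "b \<in> pverts G" "x a = -1" "x b = 1"
    using x by (metis (no_types, lifting) image_iff insertCI)
  then obtain u v where uv: "(u, v) \<in> R"
    using connected_ex_unequal_arc[OF pg _ ab(1,2), of x] assms(1) by (auto simp: cactus_def R_def)
  define d where "d = card (R `` {u})"
  have u: "u \<in> pverts G" using uv by (auto simp: R_def dest: wellformed')
  have d: "card (R `` {w}) = d" if "w \<in> pverts G" for w
    using lam[OF that] lam[OF u] by (simp add: d_def)
  have "sym R" using pair_sym_arcs by (auto simp: R_def symmetric_def sym_def)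
  \<comment> \<open>By regularity a single vertex of degree at most 2 bounds
    \<open>d\<close>.\<close>
  then have "d \<le> 2"
    using cactus_degree_le_2[OF assms(1) _ _ u, of R] d by (auto simp: R_def)
  \<comment> \<open>Finiteness is needed because a cardinality of 0 could also mean an infinite
    set.\<close>
  have "R `` {u} \<subseteq> pverts G" by (auto simp: R_def dest: wellformed')
  then have "finite (R `` {u})" using pair_finite_verts finite_subset by blast
  then have "d \<noteq> 0" using uv by (auto simp: d_def)
  then consider "d = 1" | "d = 2" using \<open>d \<le> 2\<close> by linarith
  then show ?thesis
  proof cases
    case 1
    then show ?thesis
      using formed_by_P2sI[OF pg _ R_def] x d lam[OF u] by (simp add: d_def)
  next
    case 2
    then show ?thesis
      using formed_by_even_cyclesI[OF pg _ R_def] x d lam[OF u] by (simp add: d_def)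
  qed
qed

end
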